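(* Let $X$ be a real Banach space (of dimension at least $2$). For any $r\in[0,1]$ the following inequalities hold: $$1-\frac{1}{2}\,\delta_X^{-1}\left(1-\frac{r}{2}\right)\le 1-\frac{1}{2}\,\delta_X^{-1}\left(1-\frac{r}{\xi_X}\right)\le\lambda_X^+(r).$$
   Context: Let $X$ be a real Banach space with $\dim X \ge 2$. Write $S_X=\{x\in X:\|x\|=1\}$, $B_X=\{x\in X:\|x\|\le1\}$, and for $x\in X$ let $J_1(x)=\{p\in X^*:\ \|p\|=1,\ p(x)=\|x\|\}$. For $x\in X\setminus\{0\}$ and $y\in X$, $y$ is quasiorthogonal to $x$, written $y\urcorner x$, if there is $p\in J_1(x)$ with $p(y)=0$. For $x,y\in S_X$ with $y\urcorner x$ and $r\in[0,1]$ put $\lambda_X(x,y,r)=\min\{\lambda\in\mathbb{R}:\ \|x+ry-\lambda x\|=1\}$. The modulus of supporting smoothness is $$\lambda_X^+(r)=\sup\{\lambda_X(x,y,t):\ x,y\in S_X,\ y\urcorner x,\ 0\le t\le r\},\quad r\in[0,1].$$ Put $\xi_X=\sup_{\|x\|=1,\ \|y\|=1}\ \sup_{p\in J_1(y)}\|x-p(x)\,y\|$. The modulus of convexity is $\delta_X(\varepsilon)=\inf\{1-\frac{\|x+y\|}{2}:\ x,y\in B_X,\ \|x-y\|\ge\varepsilon\}$, $\varepsilon\in[0,2]$. Its inverse function is denoted $\delta_X^{-1}$; since $\delta_X$ need not be a bijection, it is understood as $\delta_X^{-1}(s)=\sup\{\varepsilon\in[0,2]:\ \delta_X(\varepsilon)\le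 s\}$ for $s\in[0,1]$, which is the usual inverse when $\delta_X$ is invertible. *)

theory Defs
  imports "HOL-Analysis.Analysis"
begin

definition J1 :: "'a::real_normed_vector \<Rightarrow> ('a \<Rightarrow>\<^sub>L real) set" where
  "J1 x = {p. norm p = 1 \<and> blinfun_apply p x = norm x}"

definition quasiorthogonal :: "'a::real_normed_vector \<Rightarrow> 'a \<Rightarrow> bool" where
  "quasiorthogonal y x \<longleftrightarrow> x \<noteq> 0 \<and> (\<exists>p\<in>J1 x. blinfun_apply p y = 0)"

(* The set below may be infinite, so its minimum is taken with LEAST rather than Min. *)
definition supp_lambda :: "'a::real_normed_vector \<Rightarrow> 'a \<Rightarrow> real \<Rightarrow> real" where
  "supp_lambda x y r = (LEAST l. norm (x + r *\<^sub>R y - l *\<^sub>R x) = 1)"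

definition supp_smoothness :: "'a::real_normed_vector itself \<Rightarrow> real \<Rightarrow> real" where
  "supp_smoothness X r =
     Sup {supp_lambda x y t | (x::'a) y t.
            norm x = 1 \<and> norm y = 1 \<and> quasiorthogonal y x \<and> 0 \<le> t \<and> t \<le> r}"

definition xi :: "'a::real_normed_vector itself \<Rightarrow> real" where
  "xi X = (SUP (x, y)\<in>{(x::'a, y). norm x = 1 \<and> norm y = 1}.
             SUP p\<in>J1 y. norm (x - blinfun_apply p x *\<^sub>R y))"

definition convexity_modulus :: "'a::real_normed_vector itself \<Rightarrow> real \<Rightarrow> real" where
  "convexity_modulus X e =
     Inf {1 - norm (x + y) / 2 | (x::'a) y. norm x \<le> 1 \<and> norm y \<le> 1 \<and> norm (x - y) \<ge> e}"

definition convexity_modulus_inv :: "'a::real_normed_vector itself \<Rightarrow> real \<Rightarrow> real" where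
  "convexity_modulus_inv X s = Sup {e\<in>{0..2}. convexity_modulus X e \<le> s}"

end

theory Submission
  imports Defs
begin

text \<open>
  Everything happens in the plane spanned by a unit vector \<open>x\<close> and a unit vector \<open>y\<close> in the kernel
  of a functional \<open>p\<close> supporting the ball at \<open>x\<close>. Moving from \<open>x\<close> along the tangent direction
  \<open>\<plusminus>r y\<close> and then back along \<open>- x\<close> by \<open>a\<close>, respectively \<open>b\<close>, one meets the unit sphere at
  \<open>u = (1 - a) x + r y\<close> and \<open>v = (1 - b) x - r y\<close>, where \<open>a, b\<close> are at most the modulus of
  supporting smoothness \<open>L\<close> at \<open>r\<close> and \<open>L \<le> 1\<close>. The two points \<open>u\<close> and \<open>- v\<close> are far apart,
  since \<open>u + v\<close> is the multiple \<open>2 - a - b \<ge> 2 (1 - L)\<close> of \<open>x\<close>. If \<open>r > 0\<close>, their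
  midpoint \<open>(u - v) / 2\<close> has the form \<open>r (y + c x)\<close>, and it cannot be too short: normalising
  \<open>y + c x\<close> and projecting along \<open>x\<close> onto the kernel of \<open>p\<close> gives a vector of norm
  \<open>1 / norm (y + c x)\<close>, so \<open>norm (y + c x) \<ge> 1 / \<xi>\<close>. The pair \<open>u, - v\<close> therefore shows that the
  modulus of convexity at \<open>2 (1 - L)\<close> is at most \<open>1 - r / \<xi>\<close>, which is the second inequality.
  The first one is monotonicity of the inverse modulus together with \<open>\<xi> \<le> 2\<close>.

  Supporting functionals come from the Hahn-Banach theorem, proved here by descending, with
  Zorn's lemma, to a minimal sublinear functional: minimality forces linearity.
\<close>

section \<open>Sublinear functionals and the existence of supporting functionals\<close>

text \<open>
  Homogeneity is required only as an inequality, which is what passes directly to infima; the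
  reverse inequality follows by rescaling with \<open>1 / c\<close>.
\<close>

definition sublinear :: "('a::real_vector \<Rightarrow> real) \<Rightarrow> bool" where
  "sublinear q \<longleftrightarrow> q 0 = 0 \<and> (\<forall>x y. q (x + y) \<le> q x + q y) \<and>
     (\<forall>c x. 0 < c \<longrightarrow> q (c *\<^sub>R x) \<le> c * q x)"

lemma sublinear_zero: "sublinear q \<Longrightarrow> q 0 = 0"
  and sublinear_add: "sublinear q \<Longrightarrow> q (x + y) \<le> q x + q y"
  and sublinear_scale_le: "sublinear q \<Longrightarrow> 0 < c \<Longrightarrow> q (c *\<^sub>R x) \<le> c * q x"
  by (auto simp: sublinear_def)

lemma sublinear_scale:
  assumes q: "sublinear q" and c: "0 \<le> c"
  shows "q (c *\<^sub>R x) = c * q x"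
proof (cases "c = 0")
  case True
  then show ?thesis using q by (simp add: sublinear_zero)
next
  case False
  then have c: "0 < c" using c by simp
  have "q ((1 / c) *\<^sub>R (c *\<^sub>R x)) \<le> 1 / c * q (c *\<^sub>R x)"
    using c by (intro sublinear_scale_le[OF q]) simp
  then have "c * q x \<le> q (c *\<^sub>R x)" using c by (simp add: field_simps)
  with sublinear_scale_le[OF q c, of x] show ?thesis by simp
qed

lemma sublinear_neg: "sublinear q \<Longrightarrow> - q (- x) \<le> q x"
  using sublinear_add[of q x "- x"] sublinear_zero[of q] by simp

lemma sublinear_norm: "sublinear norm"
  by (simp add: sublinear_def norm_triangle_ineq)

text \<open>
  The largest sublinear functional below \<open>q\<close> whose value at \<open>- v\<close> is at most \<open>- q v\<close>.
  Tilting serves twice: it shows that minimal sublinear functionals are odd, and, applied to the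
  norm, it prescribes the value of the functional that is to be constructed.
\<close>

definition tilt :: "('a::real_vector \<Rightarrow> real) \<Rightarrow> 'a \<Rightarrow> 'a \<Rightarrow> real" where
  "tilt q v x = (INF t\<in>{0..}. q (x + t *\<^sub>R v) - t * q v)"

lemma tilt_le:
  assumes q: "sublinear q" and t: "0 \<le> t"
  shows "tilt q v x \<le> q (x + t *\<^sub>R v) - t * q v"
  unfolding tilt_def
proof (rule cINF_lower)
  show "bdd_below ((\<lambda>t. q (x + t *\<^sub>R v) - t * q v) ` {0..})"
  proof (rule bdd_belowI2[where m = "- q (- x)"])
    fix t :: real
    assume "t \<in> {0..}"
    then show "- q (- x) \<le> q (x + t *\<^sub>R v) - t * q v"
      using sublinear_add[OF q, of "x + t *\<^sub>R v" "- x"] sublinear_scale[OF q, of t v] by simp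
  qed
qed (use t in simp)

lemma tilt_greatest:
  assumes "\<And>t. 0 \<le> t \<Longrightarrow> m \<le> q (x + t *\<^sub>R v) - t * q v"
  shows "m \<le> tilt q v x"
  unfolding tilt_def using assms by (intro cINF_greatest) auto

lemma tilt_le_self: "sublinear q \<Longrightarrow> tilt q v x \<le> q x"
  using tilt_le[of q 0 v x] by simp

lemma tilt_neg: "sublinear q \<Longrightarrow> tilt q v (- v) \<le> - q v"
  using tilt_le[of q 1 v "- v"] by (simp add: sublinear_zero)

lemma sublinear_tilt:
  assumes q: "sublinear q"
  shows "sublinear (tilt q v)"
  unfolding sublinear_def
proof (intro conjI allI impI)
  show "tilt q v 0 = 0"
    using tilt_le_self[OF q, of v 0] sublinear_zero[OF q]
    by (intro antisym tilt_greatest) (auto simp: sublinear_scale[OF q])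
next
  fix x y
  have "tilt q v (x + y) - tilt q v y \<le> tilt q v x"
  proof (rule tilt_greatest)
    fix s :: real
    assume s: "0 \<le> s"
    have "tilt q v (x + y) - (q (x + s *\<^sub>R v) - s * q v) \<le> tilt q v y"
    proof (rule tilt_greatest)
      fix t :: real
      assume t: "0 \<le> t"
      have "tilt q v (x + y) \<le> q (x + y + (s + t) *\<^sub>R v) - (s + t) * q v"
        using s t by (intro tilt_le[OF q]) simp
      also have "x + y + (s + t) *\<^sub>R v = (x + s *\<^sub>R v) + (y + t *\<^sub>R v)"
        by (simp add: algebra_simps)
      also have "q \<dots> \<le> q (x + s *\<^sub>R v) + q (y + t *\<^sub>R v)"
        by (rule sublinear_add[OF q])
      finally show "tilt q v (x + y) - (q (x + s *\<^sub>R v) - s * q v) \<le> q (y + t *\<^sub>R v) - t * q v"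
        by (simp add: algebra_simps)
    qed
    then show "tilt q v (x + y) - tilt q v y \<le> q (x + s *\<^sub>R v) - s * q v" by simp
  qed
  then show "tilt q v (x + y) \<le> tilt q v x + tilt q v y" by simp
next
  fix c :: real and x
  assume c: "0 < c"
  have "tilt q v (c *\<^sub>R x) / c \<le> tilt q v x"
  proof (rule tilt_greatest)
    fix t :: real
    assume t: "0 \<le> t"
    have "tilt q v (c *\<^sub>R x) \<le> q (c *\<^sub>R x + (c * t) *\<^sub>R v) - (c * t) * q v"
      using c t by (intro tilt_le[OF q]) simp
    also have "c *\<^sub>R x + (c * t) *\<^sub>R v = c *\<^sub>R (x + t *\<^sub>R v)"
      by (simp add: algebra_simps)
    also have "q \<dots> = c * q (x + t *\<^sub>R v)"
      using c by (simp add: sublinear_scale[OF q])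
    finally show "tilt q v (c *\<^sub>R x) / c \<le> q (x + t *\<^sub>R v) - t * q v"
      using c by (simp add: field_simps)
  qed
  then show "tilt q v (c *\<^sub>R x) \<le> c * tilt q v x"
    using c by (simp add: field_simps)
qed

text \<open>
  Subadditivity survives because any two members of a chain have a smaller one among them, so that
  the same functional can be used at both arguments.
\<close>

lemma sublinear_INF_chain:
  fixes C :: "('a::real_vector \<Rightarrow> real) set"
  assumes ne: "C \<noteq> {}" and sub: "\<And>q. q \<in> C \<Longrightarrow> sublinear q"
    and chain: "\<And>p q. p \<in> C \<Longrightarrow> q \<in> C \<Longrightarrow> p \<le> q \<or> q \<le> p"
    and bdd: "\<And>x. bdd_below ((\<lambda>q. q x) ` C)"
  shows "sublinear (\<lambda>x. INF q\<in>C. q x)"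
proof -
  let ?u = "\<lambda>x. INF q\<in>C. q x"
  have low: "?u x \<le> q x" if "q \<in> C" for q x
    using that by (intro cINF_lower bdd)
  show ?thesis
    unfolding sublinear_def
  proof (intro conjI allI impI)
    have "?u 0 = (INF q\<in>C. 0::real)"
      by (rule INF_cong) (auto simp: sub sublinear_zero)
    then show "?u 0 = 0" using ne by simp
  next
    fix x y
    have "?u (x + y) - ?u y \<le> ?u x"
    proof (rule cINF_greatest[OF ne])
      fix p
      assume p: "p \<in> C"
      have "?u (x + y) - p x \<le> ?u y"
      proof (rule cINF_greatest[OF ne])
        fix q
        assume q: "q \<in> C"
        obtain w where w: "w \<in> C" "w \<le> p" "w \<le> q"
          using chain[OF p q] p q by blast
        have "?u (x + y) \<le> w (x + y)" by (rule low[OF w(1)])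
        also have "\<dots> \<le> w x + w y" by (rule sublinear_add[OF sub[OF w(1)]])
        also have "\<dots> \<le> p x + q y" using w by (intro add_mono) (auto simp: le_fun_def)
        finally show "?u (x + y) - p x \<le> q y" by simp
      qed
      then show "?u (x + y) - ?u y \<le> p x" by simp
    qed
    then show "?u (x + y) \<le> ?u x + ?u y" by simp
  next
    fix c :: real and x
    assume c: "0 < c"
    have "?u (c *\<^sub>R x) / c \<le> ?u x"
    proof (rule cINF_greatest[OF ne])
      fix q
      assume q: "q \<in> C"
      have "?u (c *\<^sub>R x) \<le> c * q x"
        using low[OF q, of "c *\<^sub>R x"] sublinear_scale_le[OF sub[OF q] c, of x] by linarith
      then show "?u (c *\<^sub>R x) / c \<le> q x"
        using c by (simp add: field_simps)
    qed
    then show "?u (c *\<^sub>R x) \<le> c * ?u x"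
      using c by (simp add: field_simps)
  qed
qed

lemma minimal_sublinear_exists:
  assumes q0: "sublinear q0"
  obtains q where "sublinear q" "q \<le> q0" "\<And>p. sublinear p \<Longrightarrow> p \<le> q \<Longrightarrow> p = q"
proof -
  define A where "A = {q. sublinear q \<and> q \<le> q0}"
  have "\<exists>m\<in>A. \<forall>a\<in>A. m \<ge> a \<longrightarrow> a = m"
  proof (rule predicate_Zorn)
    show "partial_order_on A (relation_of (\<ge>) A)"
      by (rule partial_order_on_relation_ofI) auto
  next
    fix C
    assume "C \<in> Chains (relation_of (\<ge>) A)"
    then have C: "C \<subseteq> A" and chain: "\<And>p q. p \<in> C \<Longrightarrow> q \<in> C \<Longrightarrow> p \<le> q \<or> q \<le> p"
      unfolding Chains_def relation_of_def by auto
    show "\<exists>u\<in>A. \<forall>a\<in>C. a \<ge> u"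
    proof (cases "C = {}")
      case True
      then show ?thesis using q0 by (auto simp: A_def)
    next
      case False
      have bdd: "bdd_below ((\<lambda>q. q x) ` C)" for x
      proof (rule bdd_belowI2[where m = "- q0 (- x)"])
        fix q
        assume "q \<in> C"
        then have "sublinear q" "q (- x) \<le> q0 (- x)" using C by (auto simp: A_def le_fun_def)
        then show "- q0 (- x) \<le> q x" using sublinear_neg[of q x] by linarith
      qed
      define u where "u = (\<lambda>x. INF q\<in>C. q x)"
      have u_le: "u \<le> q" if "q \<in> C" for q
        using that by (auto simp: u_def le_fun_def intro!: cINF_lower bdd)
      have "sublinear u"
        unfolding u_def using C by (intro sublinear_INF_chain False chain bdd) (auto simp: A_def)
      moreover have "u \<le> q0"
      proof -
        obtain q where "q \<in> C" using False by blast
        then show ?thesis using C u_le[of q] by (auto simp: A_def intro: order_trans)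
      qed
      ultimately show ?thesis using u_le by (auto simp: A_def)
    qed
  qed
  then obtain m where "m \<in> A" "\<And>a. a \<in> A \<Longrightarrow> a \<le> m \<Longrightarrow> a = m" by blast
  then show thesis
    by (intro that[of m]) (auto simp: A_def intro: order_trans)
qed

text \<open>
  A minimal sublinear functional coincides with all its tilts, hence it is odd; and an odd
  subadditive functional is additive.
\<close>

theorem sublinear_dominates_linear:
  assumes q0: "sublinear q0"
  obtains f where "linear f" "\<And>x. f x \<le> q0 x"
proof -
  obtain q where q: "sublinear q" and le: "q \<le> q0"
    and minimal: "\<And>p. sublinear p \<Longrightarrow> p \<le> q \<Longrightarrow> p = q"
    using minimal_sublinear_exists[OF q0] by blast
  have odd: "q (- v) = - q v" for v
  proof -
    have "tilt q v = q"
      by (intro minimal sublinear_tilt[OF q] le_funI tilt_le_self[OF q])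
    then have "q (- v) \<le> - q v" using tilt_neg[OF q, of v] by simp
    then show ?thesis using sublinear_neg[OF q, of v] by simp
  qed
  have "linear q"
  proof (rule linearI)
    fix x y
    have "q (- x + - y) \<le> q (- x) + q (- y)" by (rule sublinear_add[OF q])
    then have "q x + q y \<le> q (x + y)" using odd[of "x + y"] by (simp add: odd)
    then show "q (x + y) = q x + q y" using sublinear_add[OF q, of x y] by simp
  next
    fix c x
    show "q (c *\<^sub>R x) = c *\<^sub>R q x"
    proof (cases "0 \<le> c")
      case True
      then show ?thesis by (simp add: sublinear_scale[OF q])
    next
      case False
      then have "q ((- c) *\<^sub>R x) = - c * q x" by (intro sublinear_scale[OF q]) simp
      then show ?thesis using odd[of "c *\<^sub>R x"] by simp
    qed
  qed
  with le show thesis by (intro that[of q]) (auto simp: le_fun_def)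
qed

text \<open>
  A linear functional below \<open>tilt norm x\<close> lies below the norm and takes at \<open>- x\<close> a value at most
  \<open>- norm x\<close>.
\<close>

theorem J1_nonempty:
  fixes x :: "'a::real_normed_vector"
  assumes x: "x \<noteq> 0"
  shows "J1 x \<noteq> {}"
proof -
  obtain f :: "'a \<Rightarrow> real" where lin: "linear f" and f_tilt: "\<And>z. f z \<le> tilt norm x z"
    using sublinear_dominates_linear[OF sublinear_tilt[OF sublinear_norm]] by blast
  have f_le: "f z \<le> norm z" for z
    using f_tilt[of z] tilt_le_self[OF sublinear_norm, of x z] by linarith
  have abs_f: "\<bar>f z\<bar> \<le> norm z" for z
    using f_le[of z] f_le[of "- z"] by (simp add: linear_neg[OF lin])
  have f_x: "f x = norm x"
    using f_tilt[of "- x"] tilt_neg[OF sublinear_norm, of x] f_le[of x]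
    by (simp add: linear_neg[OF lin])
  have "bounded_linear f"
    by (rule bounded_linear_intro[where K = 1])
      (use abs_f in \<open>auto simp: linear_add[OF lin] linear_scale[OF lin]\<close>)
  then have ap: "blinfun_apply (Blinfun f) = f" by (rule bounded_linear_Blinfun_apply)
  have "norm (Blinfun f) \<le> 1"
    by (rule norm_blinfun_bound) (use abs_f in \<open>auto simp: ap\<close>)
  moreover have "1 \<le> norm (Blinfun f)"
    using norm_blinfun[of "Blinfun f" x] x by (simp add: ap f_x)
  ultimately have "Blinfun f \<in> J1 x" by (simp add: J1_def ap f_x)
  then show ?thesis by blast
qed

lemma abs_J1_le:
  assumes "p \<in> J1 x"
  shows "\<bar>blinfun_apply p z\<bar> \<le> norm z"
  using assms norm_blinfun[of p z] by (simp add: J1_def)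

text \<open>
  Of two independent vectors, the second is pushed along the first into the kernel of a functional
  supporting the first; independence keeps the result nonzero.
\<close>

lemma quasiorthogonal_pair_exists:
  assumes "\<exists>B :: 'a::real_normed_vector set. independent B \<and> card B = 2"
  obtains x y :: "'a::real_normed_vector" where "norm x = 1" "norm y = 1" "quasiorthogonal y x"
proof -
  obtain B :: "'a set" where B: "independent B" "card B = 2" using assms by blast
  then obtain u v where uv: "B = {u, v}" "u \<noteq> v" by (auto simp: card_2_iff)
  have u: "u \<noteq> 0" using B uv dependent_zero by blast
  have v_notin: "v \<notin> span {u}"
  proof
    assume "v \<in> span {u}"
    moreover have "{u, v} - {v} = {u}" using uv(2) by auto
    ultimately have "dependent {u, v}" unfolding dependent_def by (intro bexI[of _ v]) auto
    then show False using B(1) uv(1) by simp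
  qed
  obtain p where p: "p \<in> J1 u" using J1_nonempty[OF u] by blast
  define w where "w = v - (blinfun_apply p v / norm u) *\<^sub>R u"
  have "w \<noteq> 0"
  proof
    assume "w = 0"
    then have "v = (blinfun_apply p v / norm u) *\<^sub>R u" by (simp add: w_def)
    moreover have "(blinfun_apply p v / norm u) *\<^sub>R u \<in> span {u}"
      by (intro span_scale span_base) simp
    ultimately show False using v_notin by simp
  qed
  have pw: "blinfun_apply p w = 0"
    using p u by (simp add: w_def J1_def blinfun.diff_right blinfun.scaleR_right)
  show thesis
  proof (rule that[of "u /\<^sub>R norm u" "w /\<^sub>R norm w"])
    have "p \<in> J1 (u /\<^sub>R norm u)"
      using p u by (simp add: J1_def blinfun.scaleR_right)
    then show "quasiorthogonal (w /\<^sub>R norm w) (u /\<^sub>R norm u)"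
      unfolding quasiorthogonal_def using pw u by (auto simp: blinfun.scaleR_right)
  qed (use u \<open>w \<noteq> 0\<close> in auto)
qed

lemma quasiorthogonal_minus: "quasiorthogonal y x \<Longrightarrow> quasiorthogonal (- y) x"
  by (auto simp: quasiorthogonal_def blinfun.minus_right)

section \<open>The modulus of supporting smoothness\<close>

text \<open>
  The norm of \<open>(1 - l) x + t y\<close> is at least \<open>1\<close> at \<open>l = 0\<close>, by the supporting functional, and
  equals \<open>t \<le> 1\<close> at \<open>l = 1\<close>, so it takes the value \<open>1\<close> in between; for negative \<open>l\<close> it exceeds
  \<open>1\<close>, again by the supporting functional. Hence the least solution exists and lies in \<open>[0, 1]\<close>.
\<close>

lemma supp_lambda_props:
  fixes x y :: "'a::real_normed_vector"
  assumes x: "norm x = 1" and y: "norm y = 1" and qo: "quasiorthogonal y x"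
    and t: "0 \<le> t" "t \<le> 1"
  shows "norm (x + t *\<^sub>R y - supp_lambda x y t *\<^sub>R x) = 1"
    and "0 \<le> supp_lambda x y t" and "supp_lambda x y t \<le> 1"
proof -
  let ?g = "\<lambda>l. norm (x + t *\<^sub>R y - l *\<^sub>R x)"
  obtain p where p: "p \<in> J1 x" "blinfun_apply p y = 0"
    using qo by (auto simp: quasiorthogonal_def)
  have lower: "1 - l \<le> ?g l" for l
    using abs_J1_le[OF p(1), of "x + t *\<^sub>R y - l *\<^sub>R x"] p x
    by (simp add: J1_def blinfun.diff_right blinfun.add_right blinfun.scaleR_right)
  have nonneg: "0 \<le> l" if "?g l = 1" for l
    using lower[of l] that by simp
  have cont: "continuous_on S ?g" for S
    by (intro continuous_intros)
  have "\<exists>l\<ge>0. l \<le> 1 \<and> ?g l = 1"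
  proof (rule IVT2')
    show "?g 1 \<le> 1" using t y by simp
    show "1 \<le> ?g 0" using lower[of 0] by simp
  qed (auto intro: cont)
  then obtain l0 where l0: "0 \<le> l0" "l0 \<le> 1" "?g l0 = 1" by blast
  let ?S = "{l \<in> {0..1}. ?g l = 1}"
  have "closed ?S"
    by (rule continuous_closed_preimage_constant[OF cont]) simp
  then have "compact ({0..1} \<inter> ?S)"
    by (intro compact_Int_closed) auto
  moreover have "{0..1} \<inter> ?S = ?S" by blast
  ultimately have "compact ?S" by simp
  then obtain m where m: "m \<in> ?S" "\<And>l. l \<in> ?S \<Longrightarrow> m \<le> l"
    using l0 compact_attains_inf[of ?S] by auto
  have "supp_lambda x y t = m"
    unfolding supp_lambda_def
  proof (rule Least_equality)
    fix l
    assume l: "?g l = 1"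
    show "m \<le> l"
    proof (cases "l \<le> 1")
      case True
      then show ?thesis using l nonneg[OF l] by (intro m(2)) simp
    next
      case False
      then show ?thesis using m(1) by simp
    qed
  qed (use m(1) in simp)
  then show "?g (supp_lambda x y t) = 1" "0 \<le> supp_lambda x y t" "supp_lambda x y t \<le> 1"
    using m(1) by auto
qed

lemma supp_lambda_le_supp_smoothness:
  fixes x y :: "'a::real_normed_vector"
  assumes "norm x = 1" "norm y = 1" "quasiorthogonal y x" "0 \<le> t" "t \<le> r" "r \<le> 1"
  shows "supp_lambda x y t \<le> supp_smoothness TYPE('a) r"
  unfolding supp_smoothness_def
proof (rule cSup_upper)
  show "bdd_above {supp_lambda x y t | (x::'a) y t.
      norm x = 1 \<and> norm y = 1 \<and> quasiorthogonal y x \<and> 0 \<le> t \<and> t \<le> r}"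
    by (rule bdd_aboveI[where M = 1]) (use \<open>r \<le> 1\<close> in \<open>auto intro!: supp_lambda_props\<close>)
qed (use assms in auto)

lemma supp_smoothness_le_1:
  fixes x y :: "'a::real_normed_vector"
  assumes "norm x = 1" "norm y = 1" "quasiorthogonal y x" "0 \<le> r" "r \<le> 1"
  shows "supp_smoothness TYPE('a) r \<le> 1"
  unfolding supp_smoothness_def
  by (rule cSup_least) (use assms in \<open>auto intro!: supp_lambda_props(3)\<close>)

section \<open>The constant \<xi>\<close>

lemma norm_projection_le_2:
  fixes z x :: "'a::real_normed_vector"
  assumes "norm z = 1" "norm x = 1" "p \<in> J1 x"
  shows "norm (z - blinfun_apply p z *\<^sub>R x) \<le> 2"
  using norm_triangle_ineq4[of z "blinfun_apply p z *\<^sub>R x"] abs_J1_le[OF assms(3), of z] assms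
  by simp

text \<open>
  The inner supremum runs over a nonempty set by Hahn-Banach; this is what bounds the outer one.
\<close>

lemma SUP_J1_le_2:
  fixes z x :: "'a::real_normed_vector"
  assumes "norm z = 1" "norm x = 1"
  shows "(SUP p\<in>J1 x. norm (z - blinfun_apply p z *\<^sub>R x)) \<le> 2"
proof (rule cSUP_least)
  have "x \<noteq> 0" using assms(2) by auto
  then show "J1 x \<noteq> {}" by (rule J1_nonempty)
qed (use assms in \<open>rule norm_projection_le_2\<close>)

lemma xi_le_2:
  fixes x :: "'a::real_normed_vector"
  assumes "norm x = 1"
  shows "xi TYPE('a) \<le> 2"
  unfolding xi_def
  by (rule cSUP_least) (use assms SUP_J1_le_2 in auto)

lemma norm_projection_le_xi:
  fixes z x :: "'a::real_normed_vector"
  assumes z: "norm z = 1" and x: "norm x = 1" and p: "p \<in> J1 x"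
  shows "norm (z - blinfun_apply p z *\<^sub>R x) \<le> xi TYPE('a)"
proof -
  have "norm (z - blinfun_apply p z *\<^sub>R x) \<le> (SUP p\<in>J1 x. norm (z - blinfun_apply p z *\<^sub>R x))"
    using z x by (intro cSUP_upper[OF p] bdd_aboveI2[where M = 2] norm_projection_le_2)
  also have "\<dots> = (case (z, x) of (x, y) \<Rightarrow> SUP p\<in>J1 y. norm (x - blinfun_apply p x *\<^sub>R y))"
    by simp
  also have "\<dots> \<le> xi TYPE('a)"
    unfolding xi_def
    by (rule cSUP_upper) (use z x SUP_J1_le_2 in \<open>auto intro!: bdd_aboveI2[where M = 2]\<close>)
  finally show ?thesis .
qed

text \<open>
  The projection along \<open>x\<close> onto the kernel of a supporting functional sends \<open>y + c x\<close> to \<open>y\<close>,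
  and on unit vectors it produces norms at most \<open>\<xi>\<close>.
\<close>

lemma xi_times_norm_ge_1:
  fixes x y :: "'a::real_normed_vector"
  assumes x: "norm x = 1" and y: "norm y = 1" and qo: "quasiorthogonal y x"
  shows "1 \<le> xi TYPE('a) * norm (y + c *\<^sub>R x)"
proof -
  obtain p where p: "p \<in> J1 x" "blinfun_apply p y = 0"
    using qo by (auto simp: quasiorthogonal_def)
  define w where "w = y + c *\<^sub>R x"
  have pw: "blinfun_apply p w = c"
    using p x by (simp add: w_def J1_def blinfun.add_right blinfun.scaleR_right)
  have w: "w \<noteq> 0"
  proof
    assume "w = 0"
    then have "c = 0" using pw by simp
    then show False using \<open>w = 0\<close> y by (simp add: w_def)
  qed
  have "w /\<^sub>R norm w - blinfun_apply p (w /\<^sub>R norm w) *\<^sub>R x = y /\<^sub>R norm w"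
    by (simp add: blinfun.scaleR_right pw) (simp add: w_def algebra_simps)
  then have "1 / norm w \<le> xi TYPE('a)"
    using norm_projection_le_xi[of "w /\<^sub>R norm w", OF _ x p(1)] w y
    by (simp add: inverse_eq_divide)
  then show ?thesis using w by (simp add: w_def field_simps)
qed

section \<open>The modulus of convexity\<close>

lemma convexity_modulus_le:
  fixes a b :: "'a::real_normed_vector"
  assumes "norm a \<le> 1" "norm b \<le> 1" "e \<le> norm (a - b)"
  shows "convexity_modulus TYPE('a) e \<le> 1 - norm (a + b) / 2"
  unfolding convexity_modulus_def
proof (rule cInf_lower)
  show "bdd_below {1 - norm (x + y) / 2 | (x::'a) y. norm x \<le> 1 \<and> norm y \<le> 1 \<and> e \<le> norm (x - y)}"
  proof (rule bdd_belowI[where m = 0], clarify)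
    fix x y :: 'a
    assume "norm x \<le> 1" "norm y \<le> 1"
    then show "0 \<le> 1 - norm (x + y) / 2"
      using norm_triangle_ineq[of x y] by simp
  qed
qed (use assms in auto)

text \<open>
  The extremal pair consists of \<open>u\<close> and \<open>- v\<close>, where \<open>u\<close> and \<open>v\<close> are the points of the sphere
  reached from \<open>x\<close> through \<open>x + r y\<close> and \<open>x - r y\<close>.
\<close>

lemma convexity_modulus_le_via_supp_smoothness:
  fixes x y :: "'a::real_normed_vector"
  assumes x: "norm x = 1" and y: "norm y = 1" and qo: "quasiorthogonal y x"
    and r: "0 \<le> r" "r \<le> 1"
  shows "convexity_modulus TYPE('a) (2 * (1 - supp_smoothness TYPE('a) r))
           \<le> 1 - r / xi TYPE('a)"
proof -
  define L where "L = supp_smoothness TYPE('a) r"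
  define a where "a = supp_lambda x y r"
  define b where "b = supp_lambda x (- y) r"
  define u where "u = x + r *\<^sub>R y - a *\<^sub>R x"
  define v where "v = x + r *\<^sub>R (- y) - b *\<^sub>R x"
  have y': "norm (- y) = 1" and qo': "quasiorthogonal (- y) x"
    using y qo by (auto intro: quasiorthogonal_minus)
  have unit: "norm u = 1" "norm v = 1"
    unfolding u_def v_def a_def b_def
    by (rule supp_lambda_props(1)[OF x y qo r] supp_lambda_props(1)[OF x y' qo' r])+
  have ab: "a \<le> L" "b \<le> L"
    unfolding a_def b_def L_def
    using supp_lambda_le_supp_smoothness[OF x y qo r(1) _ r(2)]
      supp_lambda_le_supp_smoothness[OF x y' qo' r(1) _ r(2)] by auto
  have "u - (- v) = (2 - a - b) *\<^sub>R x"
    by (simp add: u_def v_def scaleR_diff_left scaleR_2)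
  then have "norm (u - (- v)) = \<bar>2 - a - b\<bar>" using x by simp
  then have far: "2 * (1 - L) \<le> norm (u - (- v))" using ab by simp
  have mid: "r / xi TYPE('a) \<le> norm (u + (- v)) / 2"
  proof (cases "r = 0")
    case False
    \<comment> \<open>\<open>c\<close> is the \<open>x\<close>-coefficient of \<open>u - v\<close> once the factor \<open>2 r\<close> is taken out\<close>
    define c where "c = (b - a) / (2 * r)"
    have "2 * r * c = b - a" using False by (simp add: c_def)
    then have "(2 * r) *\<^sub>R (y + c *\<^sub>R x) = (2 * r) *\<^sub>R y + (b - a) *\<^sub>R x"
      by (simp add: scaleR_add_right)
    also have "\<dots> = u + (- v)"
      by (simp only: u_def v_def mult_2 scaleR_add_left scaleR_diff_left) simp
    finally have "norm (u + (- v)) = 2 * r * norm (y + c *\<^sub>R x)"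
      using r(1) norm_scaleR[of "2 * r" "y + c *\<^sub>R x"] by simp
    moreover have ge: "1 \<le> xi TYPE('a) * norm (y + c *\<^sub>R x)"
      by (rule xi_times_norm_ge_1[OF x y qo])
    moreover have "0 < xi TYPE('a)"
      using ge mult_nonpos_nonneg[of "xi TYPE('a)" "norm (y + c *\<^sub>R x)"] by fastforce
    ultimately show ?thesis
      using r(1) mult_left_mono[OF ge r(1)] by (simp add: field_simps)
  qed simp
  have "convexity_modulus TYPE('a) (2 * (1 - L)) \<le> 1 - norm (u + (- v)) / 2"
    using unit far by (intro convexity_modulus_le) auto
  then show ?thesis using mid by (simp add: L_def)
qed

lemma convexity_modulus_inv_ge:
  assumes "e \<in> {0..2}" "convexity_modulus X e \<le> s"
  shows "e \<le> convexity_modulus_inv X s"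
  unfolding convexity_modulus_inv_def
  using assms by (intro cSup_upper) (auto intro!: bdd_aboveI[where M = 2])

text \<open>
  The witness \<open>e\<close> keeps the set for the smaller level \<open>s\<close> nonempty, so that its supremum is
  meaningful.
\<close>

lemma convexity_modulus_inv_mono:
  assumes "e \<in> {0..2}" "convexity_modulus X e \<le> s" "s \<le> s'"
  shows "convexity_modulus_inv X s \<le> convexity_modulus_inv X s'"
  unfolding convexity_modulus_inv_def
  using assms by (intro cSup_subset_mono) (auto intro!: bdd_aboveI[where M = 2])

theorem lemma8:
  fixes r :: real
  assumes "\<exists>B :: 'a::banach set. independent B \<and> card B = 2"
    and "0 \<le> r" and "r \<le> 1"
  shows "1 - convexity_modulus_inv TYPE('a) (1 - r / 2) / 2
           \<le> 1 - convexity_modulus_inv TYPE('a) (1 - r / xi TYPE('a)) / 2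
       \<and> 1 - convexity_modulus_inv TYPE('a) (1 - r / xi TYPE('a)) / 2
           \<le> supp_smoothness TYPE('a) r"
proof -
  obtain x y :: 'a where x: "norm x = 1" and y: "norm y = 1" and qo: "quasiorthogonal y x"
    using quasiorthogonal_pair_exists[OF assms(1)] by blast
  let ?L = "supp_smoothness TYPE('a) r" and ?xi = "xi TYPE('a)"
  have "0 \<le> ?L"
    using supp_lambda_props(2)[OF x y qo assms(2,3)]
      supp_lambda_le_supp_smoothness[OF x y qo assms(2) order_refl assms(3)] by linarith
  then have e: "2 * (1 - ?L) \<in> {0..2}"
    using supp_smoothness_le_1[OF x y qo assms(2,3)] by simp
  have mod: "convexity_modulus TYPE('a) (2 * (1 - ?L)) \<le> 1 - r / ?xi"
    by (rule convexity_modulus_le_via_supp_smoothness[OF x y qo assms(2,3)])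
  have "1 \<le> ?xi" using xi_times_norm_ge_1[OF x y qo, of 0] y by simp
  then have "1 - r / ?xi \<le> 1 - r / 2"
    using frac_le[OF assms(2) order_refl _ xi_le_2[OF x]] by simp
  then have "convexity_modulus_inv TYPE('a) (1 - r / ?xi) \<le> convexity_modulus_inv TYPE('a) (1 - r / 2)"
    by (rule convexity_modulus_inv_mono[OF e mod])
  with convexity_modulus_inv_ge[OF e mod] show ?thesis by simp
qed

end
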